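(* Let $\eta>0$, let $\pi_{\theta_t}$ be a member of a differentiable parametric family of policies $\{\pi_\theta:\theta\in\mathbb R^d\}$ with strictly positive probabilities, and let $\mu$ be a policy. Consider the least squares problem $$\min_{\delta\in\mathbb R^d}\;\mathbb E_{x\sim\rho,\;y\sim\pi_{\theta_t}(\cdot|x),\;y'\sim\mu(\cdot|x)}\left(\frac1\eta\big(\nabla_\theta\ln\pi_{\theta_t}(y|x)-\nabla_\theta\ln\pi_{\theta_t}(y'|x)\big)^\top\delta-\big(r(x,y)-r(x,y')\big)\right)^2 .$$ Then its minimum (Euclidean) norm minimizer $\delta^\star$ is $$\delta^\star=\eta\,F_t^{\dagger}\left(\mathbb E_{x\sim\rho,\;y\sim\pi_{mix}(\cdot|x)}\big[\nabla_\theta\ln\pi_{\theta_t}(y|x)\,A^{\pi_t}(x,y)\big]\right),$$ where $\pi_{mix}(\cdot|x)=\big(\pi_{\theta_t}(\cdot|x)+\mu(\cdot|x)\big)/2$, $$F_t=\mathbb E_{x\sim\rho,\;y\sim\pi_{mix}(\cdot|x)}\big[\nabla_\theta\ln\pi_{\theta_t}(y|x)\,(\nabla_\theta\ln\pi_{\theta_t}(y|x))^\top\big],$$ $F_t^\dagger$ is the Moore–Penrose pseudo-inverse of $F_t$, and $A^{\pi_t}(x,y)=r(x,y)-\mathbb E_{y'\sim\pi_{\theta_t}(\cdot|x)}r(x,y')$.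
   Context: $\mathcal X$ is a (measurable) space of prompts with a probability distribution $\rho$; $\mathcal Y$ is a finite set of responses. A policy is a (measurable) map $\pi$ from $\mathcal X$ to probability distributions on $\mathcal Y$, written $\pi(y|x)$. $r:\mathcal X\times\mathcal Y\to\mathbb R$ is a (measurable) reward function. $\nabla_\theta\ln\pi_{\theta_t}(y|x)$ denotes the gradient of $\theta\mapsto\ln\pi_\theta(y|x)$ evaluated at $\theta=\theta_t$. In the expectation over $(x,y,y')$, $y$ and $y'$ are drawn independently given $x$. It is assumed that $\mathbb E_{x\sim\rho}\max_y r(x,y)^2<\infty$ and $\mathbb E_{x\sim\rho}\max_y\|\nabla_\theta\ln\pi_{\theta_t}(y|x)\|^2<\infty$, so that all expectations are finite. *)

theory Defs
  imports "HOL-Probability.Probability"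
begin

definition is_policy :: "'x measure \<Rightarrow> ('x \<Rightarrow> 'y::finite pmf) \<Rightarrow> bool" where
  "is_policy \<rho> p \<longleftrightarrow>
     (\<lambda>x. measure_pmf (p x)) \<in> measurable \<rho> (prob_algebra (count_space UNIV))"

(* E_{x ~ rho, y ~ p(.|x)} f(x,y).  The expectation over (x,y,y') with y, y' independent given x
   is obtained by taking p x to be a pair_pmf. *)
definition policy_expectation ::
    "'x measure \<Rightarrow> ('x \<Rightarrow> 'y pmf) \<Rightarrow> ('x \<Rightarrow> 'y \<Rightarrow> 'b::{banach, second_countable_topology}) \<Rightarrow> 'b"
  where
  "policy_expectation \<rho> p f = (\<integral>x. measure_pmf.expectation (p x) (f x) \<partial>\<rho>)"

definition mix_policy ::
    "('x \<Rightarrow> 'y::finite pmf) \<Rightarrow> ('x \<Rightarrow> 'y pmf) \<Rightarrow> 'x \<Rightarrow> 'y pmf" where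
  "mix_policy p q x = embed_pmf (\<lambda>y. (pmf (p x) y + pmf (q x) y) / 2)"

lemma pmf_mix_policy:
  "pmf (mix_policy p q x) y = (pmf (p x) y + pmf (q x) y) / 2"
proof -
  have "(\<Sum>y\<in>UNIV. (pmf (p x) y + pmf (q x) y) / 2) = 1"
    by (simp add: sum_divide_distrib [symmetric] sum.distrib sum_pmf_eq_1)
  then have "(\<integral>\<^sup>+y. ennreal ((pmf (p x) y + pmf (q x) y) / 2) \<partial>count_space UNIV) = 1"
    by (simp add: nn_integral_count_space_finite)
  then show ?thesis
    unfolding mix_policy_def by (intro pmf_embed_pmf) simp_all
qed

definition gradient :: "('a::real_inner \<Rightarrow> real) \<Rightarrow> 'a \<Rightarrow> 'a" where
  "gradient f \<theta> = (THE D. GDERIV f \<theta> :> D)"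

lemma gradient_eqI:
  assumes "GDERIV f \<theta> :> D"
  shows "gradient f \<theta> = D"
  unfolding gradient_def
proof (rule the_equality)
  show "GDERIV f \<theta> :> D"
    by (fact assms)
next
  fix D' assume "GDERIV f \<theta> :> D'"
  then have "(\<lambda>h. h \<bullet> D') = (\<lambda>h. h \<bullet> D)"
    using assms unfolding gderiv_def by (rule has_derivative_unique)
  then show "D' = D"
    by (metis vector_eq_ldot)
qed

definition score ::
    "('a::real_inner \<Rightarrow> 'x \<Rightarrow> 'y pmf) \<Rightarrow> 'a \<Rightarrow> 'x \<Rightarrow> 'y \<Rightarrow> 'a" where
  "score \<pi> \<theta>\<^sub>t x y = gradient (\<lambda>\<theta>. ln (pmf (\<pi> \<theta> x) y)) \<theta>\<^sub>t"

definition advantage ::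
    "('x \<Rightarrow> 'y pmf) \<Rightarrow> ('x \<Rightarrow> 'y \<Rightarrow> real) \<Rightarrow> 'x \<Rightarrow> 'y \<Rightarrow> real" where
  "advantage p r x y = r x y - measure_pmf.expectation (p x) (r x)"

definition fisher_matrix ::
    "'x measure \<Rightarrow> ('x \<Rightarrow> 'y pmf) \<Rightarrow> ('x \<Rightarrow> 'y \<Rightarrow> real^'d) \<Rightarrow> real^'d^'d" where
  "fisher_matrix \<rho> p g =
     policy_expectation \<rho> p (\<lambda>x y. columnvector (g x y) ** (rowvector (g x y) :: real^'d^1))"

definition pairwise_loss ::
    "'x measure \<Rightarrow> real \<Rightarrow> ('x \<Rightarrow> 'y pmf) \<Rightarrow> ('x \<Rightarrow> 'y pmf) \<Rightarrow> ('x \<Rightarrow> 'y \<Rightarrow> real) \<Rightarrow>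
     ('x \<Rightarrow> 'y \<Rightarrow> real^'d) \<Rightarrow> real^'d \<Rightarrow> real" where
  "pairwise_loss \<rho> \<eta> p q r g \<delta> =
     policy_expectation \<rho> (\<lambda>x. pair_pmf (p x) (q x))
       (\<lambda>x (y, y'). (1 / \<eta> * ((g x y - g x y') \<bullet> \<delta>) - (r x y - r x y'))\<^sup>2)"

definition is_min_norm_minimizer :: "('a::real_normed_vector \<Rightarrow> real) \<Rightarrow> 'a \<Rightarrow> bool" where
  "is_min_norm_minimizer L = is_arg_min norm (is_arg_min L (\<lambda>_. True))"

definition is_moore_penrose :: "real^'n^'m \<Rightarrow> real^'m^'n \<Rightarrow> bool" where
  "is_moore_penrose A X \<longleftrightarrow>
     A ** X ** A = A \<and> X ** A ** X = X \<and>
     transpose (A ** X) = A ** X \<and> transpose (X ** A) = X ** A"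

definition pseudo_inverse :: "real^'n^'m \<Rightarrow> real^'m^'n" where
  "pseudo_inverse A = (THE X. is_moore_penrose A X)"

lemma is_moore_penrose_unique:
  assumes X: "is_moore_penrose A X" and Y: "is_moore_penrose A Y"
  shows "X = Y"
proof -
  have AX: "A ** X = A ** Y"
  proof -
    have "A ** X = (A ** Y) ** (A ** X)"
      using Y by (simp add: is_moore_penrose_def matrix_mul_assoc)
    also have "\<dots> = transpose ((A ** X) ** (A ** Y))"
      using X Y by (simp add: is_moore_penrose_def matrix_transpose_mul)
    also have "(A ** X) ** (A ** Y) = A ** Y"
      using X by (simp add: is_moore_penrose_def matrix_mul_assoc)
    finally show ?thesis
      using Y by (simp add: is_moore_penrose_def)
  qed
  have XA: "X ** A = Y ** A"
  proof -
    have "X ** A = (X ** A) ** (Y ** A)"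
      using Y unfolding is_moore_penrose_def by (metis matrix_mul_assoc)
    also have "\<dots> = transpose ((Y ** A) ** (X ** A))"
      using X Y by (simp add: is_moore_penrose_def matrix_transpose_mul)
    also have "(Y ** A) ** (X ** A) = Y ** A"
      using X unfolding is_moore_penrose_def by (metis matrix_mul_assoc)
    finally show ?thesis
      using Y by (simp add: is_moore_penrose_def)
  qed
  have "X = X ** A ** X"
    using X by (simp add: is_moore_penrose_def)
  also have "\<dots> = Y ** A ** Y"
    using AX XA by (metis matrix_mul_assoc)
  also have "\<dots> = Y"
    using Y by (simp add: is_moore_penrose_def)
  finally show ?thesis .
qed

lemma pseudo_inverse_eqI: "is_moore_penrose A X \<Longrightarrow> pseudo_inverse A = X"
  unfolding pseudo_inverse_def by (blast intro: the_equality is_moore_penrose_unique)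

end

theory Submission
  imports Defs
begin

text \<open>The score has mean zero under the current policy \<open>\<pi>\<close>, so at each prompt the pairwise difference of
  \<open>h = (1/\<eta>) score \<cdot> \<delta> - r\<close> equals that of the \<open>\<pi>\<close>-centered function \<open>u = (1/\<eta>) score \<cdot> \<delta> - A\<close>, and by
  independence \<open>E (u(y) - u(y'))\<^sup>2 = E\<^sub>\<pi> u\<^sup>2 + E\<^sub>\<mu> u\<^sup>2\<close>, which is twice the mean of \<open>u\<^sup>2\<close> under the mixture.  The loss is thus
  a nonnegative quadratic with Hessian proportional to the Fisher matrix \<open>F\<close>; nonnegativity alone forces \<open>F\<close>
  to be positive semidefinite and the linear term \<open>b\<close> to lie in the range of \<open>F\<close>, so the minimizers
  are the \<open>\<eta> v\<close> with \<open>F v = b\<close>, and the pseudo-inverse picks the shortest one.\<close>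

section \<open>Symmetric matrices, orthogonal projections and the pseudo-inverse\<close>

lemma inner_transpose_matrix_vector:
  fixes A :: "real^'n^'m"
  shows "(transpose A *v x) \<bullet> y = x \<bullet> (A *v y)"
  by (simp add: dot_lmul_matrix)

lemma symmetric_matrix_iff:
  fixes A :: "real^'n^'n"
  shows "transpose A = A \<longleftrightarrow> (\<forall>x y. (A *v x) \<bullet> y = x \<bullet> (A *v y))"
proof
  assume *: "\<forall>x y. (A *v x) \<bullet> y = x \<bullet> (A *v y)"
  have "(transpose A *v x) \<bullet> y = (A *v x) \<bullet> y" for x y
    unfolding inner_transpose_matrix_vector using * by simp
  then have "transpose A *v x = A *v x" for x
    by (metis vector_eq_rdot)
  then show "transpose A = A"
    by (simp add: matrix_eq)
qed (metis inner_transpose_matrix_vector)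

text \<open>Fourier expansion in an orthogonal basis of \<open>S\<close> is linear and self-adjoint,
  and its matrix is the projection.\<close>

lemma orthogonal_projection_matrix_exists:
  fixes S :: "(real^'n) set"
  assumes "subspace S"
  obtains P :: "real^'n^'n"
  where "transpose P = P" "\<And>v. P *v v \<in> S" "\<And>v. v \<in> S \<Longrightarrow> P *v v = v"
proof -
  obtain B where B: "B \<subseteq> S" "pairwise orthogonal B" "span B = S"
    using orthogonal_basis_subspace[OF assms] by metis
  define f where "f v = (\<Sum>b\<in>B. (b \<bullet> v / (b \<bullet> b)) *\<^sub>R b)" for v
  have "linear f"
    unfolding f_def
    by (intro linearI)
       (simp_all add: inner_add_right add_divide_distrib scaleR_add_left sum.distrib scaleR_sum_right)
  then have P: "matrix f *v v = f v" for v
    by (simp add: matrix_works)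
  have in_S: "f v \<in> S" for v
    unfolding f_def using B assms by (intro subspace_sum subspace_scale) auto
  show thesis
  proof
    have "f x \<bullet> y = x \<bullet> f y" for x y
      unfolding f_def by (auto simp: inner_sum_left inner_sum_right inner_commute intro!: sum.cong)
    then show "transpose (matrix f) = matrix f"
      by (simp add: symmetric_matrix_iff P)
  next
    fix v assume v: "v \<in> S"
    then have "v - f v \<in> S"
      using in_S assms by (simp add: subspace_diff)
    \<comment> \<open>The Gram-Schmidt residual is orthogonal to the whole span of \<open>B\<close>.
      For \<open>v\<close> in \<open>S\<close> it also lies in that span, so it is orthogonal to
      itself.\<close>
    then have "orthogonal (v - f v) (v - f v)"
      using Gram_Schmidt_step[OF B(2), of "v - f v" v] B(3) by (simp add: f_def)
    then show "matrix f *v v = v"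
      by (simp add: P orthogonal_self)
  qed (use in_S P in auto)
qed

text \<open>With \<^term>\<open>P\<close> the projection onto the range of \<^term>\<open>A\<close>, the matrix \<^term>\<open>A + (mat 1 - P)\<close> is
  invertible and commutes with \<^term>\<open>P\<close>; its inverse times \<^term>\<open>P\<close> is the pseudo-inverse.\<close>

lemma is_moore_penrose_pseudo_inverse_symmetric:
  fixes A :: "real^'n^'n"
  assumes sym: "transpose A = A"
  shows "is_moore_penrose A (pseudo_inverse A)"
proof -
  have "subspace (range ((*v) A))"
    by (simp add: linear_subspace_image)
  then obtain P where P: "transpose P = P" "\<And>v. P *v v \<in> range ((*v) A)"
      and P_range: "\<And>v. v \<in> range ((*v) A) \<Longrightarrow> P *v v = v"
    using orthogonal_projection_matrix_exists by metis
  have PA: "P ** A = A"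
    using P_range by (simp add: matrix_eq flip: matrix_vector_mul_assoc)
  then have AP: "A ** P = A"
    using sym P(1) by (metis matrix_transpose_mul)
  have PP: "P ** P = P"
    using P_range P(2) by (simp add: matrix_eq flip: matrix_vector_mul_assoc)
  define B where "B = A + (mat 1 - P)"
  have PB: "P ** B = A"
    using PA PP by (simp add: B_def matrix_eq algebra_simps flip: matrix_vector_mul_assoc)
  have BP: "B ** P = A"
    using AP PP by (simp add: B_def matrix_eq algebra_simps flip: matrix_vector_mul_assoc)
  \<comment> \<open>Multiplying by \<open>P\<close> puts \<open>x\<close> into the kernel of
    \<open>A\<close>, and what remains of \<open>B *v x = 0\<close> puts it into the range. For
    symmetric \<open>A\<close> these meet only in 0.\<close>
  have "x = 0" if "B *v x = 0" for x
  proof -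
    have "A *v x = 0"
      by (metis PB that matrix_vector_mul_assoc matrix_vector_mult_0_right)
    then have "x = P *v x"
      using that by (simp add: B_def matrix_vector_mult_add_rdistrib matrix_vector_mult_diff_rdistrib)
    then obtain z where z: "x = A *v z"
      using P(2)[of x] by auto
    have "x \<bullet> x = (A *v x) \<bullet> z"
      using sym unfolding z symmetric_matrix_iff by simp
    with \<open>A *v x = 0\<close> show "x = 0" by simp
  qed
  then obtain C where CB: "C ** B = mat 1"
    using matrix_left_invertible_ker by blast
  then have BC: "B ** C = mat 1"
    using matrix_left_right_inverse by blast
  have AC: "A ** C = P"
    by (metis PB BC matrix_mul_assoc matrix_mul_rid)
  have CA: "C ** A = P"
    by (metis BP CB matrix_mul_assoc matrix_mul_lid)
  \<comment> \<open>Multiplied by \<open>A\<close> on either side, \<open>C ** P\<close> gives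
    \<open>P\<close>, which is symmetric and acts as the identity on the range of
    \<open>A\<close>.\<close>
  have "is_moore_penrose A (C ** P)"
    unfolding is_moore_penrose_def
    by (metis AC CA AP PA PP P(1) matrix_mul_assoc)
  then show ?thesis
    using pseudo_inverse_eqI by metis
qed

text \<open>\<open>X ** A\<close> is the orthogonal projection onto the complement of the kernel of
  \<open>A\<close>, and it sends every solution to \<open>X *v c\<close>. Each solution is therefore
  \<open>X *v c\<close> plus an orthogonal remainder, and Pythagoras gives both minimality and
  uniqueness. The vector \<open>z\<close> witnesses that the system is solvable.\<close>

lemma min_norm_solution_iff:
  fixes A :: "real^'n^'m"
  assumes X: "is_moore_penrose A X" and c: "c = A *v z"
  shows "is_arg_min norm (\<lambda>v. A *v v = c) v \<longleftrightarrow> v = X *v c"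
proof -
  have sol: "A *v (X *v c) = c"
    using X unfolding c is_moore_penrose_def by (metis matrix_vector_mul_assoc)
  have pyth: "(norm w)\<^sup>2 = (norm (X *v c))\<^sup>2 + (norm (w - X *v c))\<^sup>2" if "A *v w = c" for w
  proof -
    have XA: "transpose (X ** A) = X ** A" "(X ** A) *v (X *v c) = X *v c" "(X ** A) *v w = X *v c"
      using X that unfolding is_moore_penrose_def by (auto simp: matrix_vector_mul_assoc)
    then have "(X *v c) \<bullet> (w - X *v c) = 0"
      by (metis (no_types, lifting) inner_diff_right symmetric_matrix_iff right_minus_eq)
    then have "orthogonal (X *v c) (w - X *v c)"
      by (simp add: orthogonal_def)
    from norm_add_Pythagorean[OF this] show ?thesis
      by simp
  qed
  then have le: "norm (X *v c) \<le> norm w" if "A *v w = c" for w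
    using that by (metis le_add_same_cancel1 norm_ge_zero power2_le_imp_le zero_le_power2)
  show ?thesis
  proof
    assume v: "is_arg_min norm (\<lambda>v. A *v v = c) v"
    then have Av: "A *v v = c" and "norm v \<le> norm (X *v c)"
      using sol by (auto simp: is_arg_min_def not_less)
    then have "norm v = norm (X *v c)"
      using le by (simp add: antisym)
    then show "v = X *v c"
      using pyth[OF Av] by simp
  qed (use sol le in \<open>auto simp: is_arg_min_def not_less\<close>)
qed

section \<open>Minimum norm minimizers of nonnegative quadratics\<close>

lemma nonneg_affine_imp_zero:
  fixes a c :: real
  assumes "\<And>t. 0 \<le> a * t + c"
  shows "a = 0"
proof (rule ccontr)
  assume "a \<noteq> 0"
  then show False
    \<comment> \<open>At this point the affine function takes the value -1.\<close>
    using assms[of "(-1 - c) / a"] by simp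
qed

text \<open>Completing the square around a solution of \<open>A *v z = b\<close> identifies the
  minimizers with the scaled solutions, among which the pseudo-inverse selects the shortest.
  Positive semidefiniteness of \<open>A\<close> and solvability are not assumed: both follow from
  \<open>L\<close> being bounded below by 0. Writing the argument as
  \<open>\<eta> *\<^sub>R v\<close> keeps \<eta> out of the quadratic.\<close>

lemma is_min_norm_minimizer_quadratic:
  fixes A :: "real^'n^'n" and L :: "real^'n \<Rightarrow> real"
  assumes sym: "transpose A = A"
    and "k > 0" "\<eta> > 0"
    and L: "\<And>v. L (\<eta> *\<^sub>R v) = k * (v \<bullet> (A *v v) - 2 * (b \<bullet> v) + c)"
    and nonneg: "\<And>v. 0 \<le> L v"
  shows "is_min_norm_minimizer L \<delta> \<longleftrightarrow> \<delta> = \<eta> *\<^sub>R (pseudo_inverse A *v b)"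
proof -
  define X where "X = pseudo_inverse A"
  have X: "is_moore_penrose A X"
    using is_moore_penrose_pseudo_inverse_symmetric[OF sym] by (simp add: X_def)
  have A_sym: "(A *v x) \<bullet> y = x \<bullet> (A *v y)" for x y
    using sym by (simp add: symmetric_matrix_iff)
  have Q: "0 \<le> v \<bullet> (A *v v) - 2 * (b \<bullet> v) + c" for v
    using nonneg[of "\<eta> *\<^sub>R v"] \<open>k > 0\<close> by (simp add: L zero_le_mult_iff)
  have psd: "0 \<le> v \<bullet> (A *v v)" for v
  proof (rule ccontr)
    assume "\<not> 0 \<le> v \<bullet> (A *v v)"
    then have neg: "v \<bullet> (A *v v) < 0" by simp
    \<comment> \<open>Scaling by \<open>t\<close> makes the quadratic term low enough to outweigh
      \<open>c\<close>; averaging over \<open>t\<close> and \<open>- t\<close> then removes the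
      linear term.\<close>
    define t where "t = sqrt ((\<bar>c\<bar> + 1) / - (v \<bullet> (A *v v)))"
    have "t\<^sup>2 * (v \<bullet> (A *v v)) = - (\<bar>c\<bar> + 1)"
      using neg by (simp add: t_def field_simps)
    moreover have "0 \<le> t\<^sup>2 * (v \<bullet> (A *v v)) + c"
      using Q[of "t *\<^sub>R v"] Q[of "- t *\<^sub>R v"]
      by (simp add: matrix_vector_mult_scaleR power2_eq_square del: scaleR_minus_left)
    ultimately show False by linarith
  qed
  have b_range: "A *v (X *v b) = b"
  proof -
    \<comment> \<open>\<open>w\<close> is the component of \<open>b\<close> orthogonal to the range
      of \<open>A\<close>, hence in its kernel. Along \<open>w\<close> the quadratic is affine, and
      a nonnegative affine function is constant, which forces \<open>w\<close> to vanish.\<close>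
    define w where "w = b - A *v (X *v b)"
    have "A ** (A ** X) = A"
      using X sym unfolding is_moore_penrose_def by (metis matrix_transpose_mul)
    then have Aw: "A *v w = 0"
      unfolding w_def by (simp add: matrix_vector_mult_diff_distrib matrix_vector_mul_assoc)
    have "0 \<le> - 2 * (b \<bullet> w) * t + c" for t
      using Q[of "t *\<^sub>R w"] by (simp add: matrix_vector_mult_scaleR Aw ac_simps)
    then have "b \<bullet> w = 0"
      using nonneg_affine_imp_zero by fastforce
    moreover have "w \<bullet> (A *v (X *v b)) = 0"
      using A_sym[of w] Aw by simp
    ultimately have "w \<bullet> w = 0"
      by (subst (2) w_def) (simp add: inner_diff_right inner_commute)
    then show ?thesis by (simp add: w_def)
  qed
  define z where "z = X *v b"
  have Q_diff: "L (\<eta> *\<^sub>R v) = L (\<eta> *\<^sub>R z) + k * ((v - z) \<bullet> (A *v (v - z)))" for v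
    using b_range[folded z_def] A_sym[of z v] A_sym[of v z]
    unfolding L by (simp add: algebra_simps matrix_vector_mult_diff_distrib inner_diff inner_commute)
  have null: "A *v v = 0" if "v \<bullet> (A *v v) = 0" for v
  proof -
    define u where "u = A *v v"
    \<comment> \<open>Moving from \<open>u\<close> in the direction \<open>v\<close>, the term in
      the square of \<open>t\<close> disappears because \<open>v\<close> is isotropic, so the form
      is affine in \<open>t\<close>.\<close>
    have "0 \<le> 2 * (u \<bullet> u) * t + u \<bullet> (A *v u)" for t
      using psd[of "u + t *\<^sub>R v"] that A_sym[of v u]
      by (simp add: matrix_vector_right_distrib matrix_vector_mult_scaleR inner_add u_def ac_simps inner_commute)
    then have "2 * (u \<bullet> u) = 0"
      by (rule nonneg_affine_imp_zero)
    then show ?thesis by (simp add: u_def)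
  qed
  have minimizer: "is_arg_min L (\<lambda>_. True) (\<eta> *\<^sub>R v) \<longleftrightarrow> A *v v = b" for v
  proof
    assume "is_arg_min L (\<lambda>_. True) (\<eta> *\<^sub>R v)"
    then have "L (\<eta> *\<^sub>R v) \<le> L (\<eta> *\<^sub>R z)"
      by (simp add: is_arg_min_def not_less)
    then have "k * ((v - z) \<bullet> (A *v (v - z))) \<le> 0"
      using Q_diff[of v] by simp
    then have "(v - z) \<bullet> (A *v (v - z)) = 0"
      using \<open>k > 0\<close> psd[of "v - z"] by (simp add: mult_le_0_iff)
    from null[OF this] show "A *v v = b"
      using b_range by (simp add: z_def matrix_vector_mult_diff_distrib)
  next
    assume "A *v v = b"
    then have "L (\<eta> *\<^sub>R v) = L (\<eta> *\<^sub>R z)"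
      using Q_diff[of v] b_range by (simp add: z_def matrix_vector_mult_diff_distrib)
    moreover have "L (\<eta> *\<^sub>R z) \<le> L w" for w
      using Q_diff[of "(1 / \<eta>) *\<^sub>R w"] psd \<open>k > 0\<close> \<open>\<eta> > 0\<close> by simp
    ultimately show "is_arg_min L (\<lambda>_. True) (\<eta> *\<^sub>R v)"
      by (simp add: is_arg_min_def not_less)
  qed
  define v where "v = (1 / \<eta>) *\<^sub>R \<delta>"
  have \<delta>: "\<delta> = \<eta> *\<^sub>R v"
    using \<open>\<eta> > 0\<close> by (simp add: v_def)
  \<comment> \<open>Scaling by \<eta> is a bijection, so the competitors in the norm comparison may
    be taken of the form to which \<open>minimizer\<close> applies.\<close>
  have scale: "(\<forall>w. P w) \<longleftrightarrow> (\<forall>w. P (\<eta> *\<^sub>R w))" for P :: "real^'n \<Rightarrow> bool"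
  proof
    assume *: "\<forall>w. P (\<eta> *\<^sub>R w)"
    show "\<forall>w. P w"
    proof
      fix w show "P w"
        using spec[OF *, of "(1 / \<eta>) *\<^sub>R w"] \<open>\<eta> > 0\<close> by simp
    qed
  qed simp
  have "is_min_norm_minimizer L \<delta> \<longleftrightarrow> is_arg_min norm (\<lambda>v. A *v v = b) v"
    unfolding is_min_norm_minimizer_def \<delta> is_arg_min_linorder[of norm]
      scale[of "\<lambda>w. is_arg_min L (\<lambda>_. True) w \<longrightarrow> norm (\<eta> *\<^sub>R v) \<le> norm w"] minimizer
    using \<open>\<eta> > 0\<close> by simp
  also have "\<dots> \<longleftrightarrow> v = X *v b"
    by (rule min_norm_solution_iff[OF X b_range[symmetric]])
  also have "\<dots> \<longleftrightarrow> \<delta> = \<eta> *\<^sub>R (X *v b)"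
    using \<open>\<eta> > 0\<close> by (simp add: \<delta>)
  finally show ?thesis by (simp add: X_def)
qed

section \<open>Gradients, their measurability and the mean of the score\<close>

text \<open>This is Riesz representation in finite dimension: the derivative is the inner product
  with the vector of its values on the basis.\<close>

lemma differentiable_imp_GDERIV_gradient:
  fixes f :: "'a::euclidean_space \<Rightarrow> real"
  assumes "f differentiable (at \<theta>)"
  shows "GDERIV f \<theta> :> gradient f \<theta>"
proof -
  obtain f' where f': "(f has_derivative f') (at \<theta>)"
    using assms by (auto simp: differentiable_def)
  interpret f': bounded_linear f'
    by (rule has_derivative_bounded_linear[OF f'])
  define D where "D = (\<Sum>b\<in>Basis. f' b *\<^sub>R b)"
  have "f' = (\<lambda>h. h \<bullet> D)"
  proof
    fix h
    have "f' h = f' (\<Sum>b\<in>Basis. (h \<bullet> b) *\<^sub>R b)"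
      by (simp add: euclidean_representation)
    also have "\<dots> = h \<bullet> D"
      by (simp add: D_def f'.sum f'.scaleR inner_sum_right mult.commute)
    finally show "f' h = h \<bullet> D" .
  qed
  then have "GDERIV f \<theta> :> D"
    using f' unfolding gderiv_def by presburger
  then show ?thesis
    using gradient_eqI by metis
qed

lemma GDERIV_sum:
  assumes "\<And>i. i \<in> I \<Longrightarrow> GDERIV (f i) x :> D i"
  shows "GDERIV (\<lambda>x. \<Sum>i\<in>I. f i x) x :> (\<Sum>i\<in>I. D i)"
  using assms unfolding gderiv_def inner_sum_right by (rule has_derivative_sum)

text \<open>Each coordinate is a pointwise limit of difference quotients, which are measurable in
  \<open>x\<close>. This yields measurability of the score from that of the policies.\<close>

lemma borel_measurable_gradient:
  fixes f :: "'x \<Rightarrow> 'a::euclidean_space \<Rightarrow> real"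
  assumes meas: "\<And>\<theta>. (\<lambda>x. f x \<theta>) \<in> borel_measurable M"
    and diff: "\<And>x. x \<in> space M \<Longrightarrow> f x differentiable (at \<theta>)"
  shows "(\<lambda>x. gradient (f x) \<theta>) \<in> borel_measurable M"
proof (subst borel_measurable_euclidean_space, intro ballI)
  fix i :: 'a assume "i \<in> Basis"
  \<comment> \<open>The successor keeps every step nonzero, so \<open>h\<close> tends to 0 within
    the punctured neighbourhood filter.\<close>
  define h where "h n = inverse (real (Suc n))" for n
  have h: "filterlim h (at 0) sequentially"
    using LIMSEQ_inverse_real_of_nat by (simp add: filterlim_at h_def[abs_def])
  show "(\<lambda>x. gradient (f x) \<theta> \<bullet> i) \<in> borel_measurable M"
  proof (rule borel_measurable_LIMSEQ_real)
    show "(\<lambda>x. (f x (\<theta> + h n *\<^sub>R i) - f x \<theta>) / h n) \<in> borel_measurable M" for n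
      using meas by simp
    show "(\<lambda>n. (f x (\<theta> + h n *\<^sub>R i) - f x \<theta>) / h n) \<longlonglongrightarrow> gradient (f x) \<theta> \<bullet> i"
      if "x \<in> space M" for x
    proof -
      have "(f x has_derivative (\<lambda>h. h \<bullet> gradient (f x) \<theta>)) (at (\<theta> + 0 *\<^sub>R i))"
        using differentiable_imp_GDERIV_gradient[OF diff[OF that]] by (simp add: gderiv_def)
      then have "((\<lambda>t. f x (\<theta> + t *\<^sub>R i)) has_derivative (\<lambda>t. (t *\<^sub>R i) \<bullet> gradient (f x) \<theta>)) (at 0)"
        by (rule has_derivative_compose[rotated]) (auto intro!: derivative_eq_intros)
      then have "((\<lambda>t. f x (\<theta> + t *\<^sub>R i)) has_field_derivative gradient (f x) \<theta> \<bullet> i) (at 0)"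
        by (simp add: has_field_derivative_def inner_commute mult_commute_abs)
      then have "((\<lambda>t. (f x (\<theta> + t *\<^sub>R i) - f x \<theta>) / t) \<longlongrightarrow> gradient (f x) \<theta> \<bullet> i) (at 0)"
        by (simp add: DERIV_def)
      from filterlim_compose[OF this h] show ?thesis .
    qed
  qed
qed

lemma differentiable_ln_compose:
  fixes f :: "'a::real_normed_vector \<Rightarrow> real"
  assumes "f differentiable (at \<theta>)" "f \<theta> > 0"
  shows "(\<lambda>\<theta>. ln (f \<theta>)) differentiable (at \<theta>)"
proof -
  obtain f' where "(f has_derivative f') (at \<theta>)"
    using assms by (auto simp: differentiable_def)
  from has_derivative_ln[of f \<theta>, OF assms(2) this] show ?thesis
    unfolding differentiable_def by blast
qed

text \<open>Weighting the logarithmic derivative by the probability gives back the gradient of the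
  probability, and the probabilities sum to the constant 1.\<close>

lemma expectation_score_eq_0:
  fixes \<pi> :: "'a::euclidean_space \<Rightarrow> 'x \<Rightarrow> 'y::finite pmf"
  assumes pos: "\<And>y. pmf (\<pi> \<theta> x) y > 0"
    and diff: "\<And>y. (\<lambda>\<theta>'. pmf (\<pi> \<theta>' x) y) differentiable (at \<theta>)"
  shows "(\<Sum>y\<in>UNIV. pmf (\<pi> \<theta> x) y *\<^sub>R score \<pi> \<theta> x y) = 0"
proof -
  define D where "D y = gradient (\<lambda>\<theta>'. pmf (\<pi> \<theta>' x) y) \<theta>" for y
  have D: "GDERIV (\<lambda>\<theta>'. pmf (\<pi> \<theta>' x) y) \<theta> :> D y" for y
    unfolding D_def using diff by (rule differentiable_imp_GDERIV_gradient)
  have "GDERIV (\<lambda>\<theta>'. ln (pmf (\<pi> \<theta>' x) y)) \<theta> :> inverse (pmf (\<pi> \<theta> x) y) *\<^sub>R D y" for y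
    using GDERIV_DERIV_compose[OF D DERIV_ln[OF pos]] .
  then have "score \<pi> \<theta> x y = inverse (pmf (\<pi> \<theta> x) y) *\<^sub>R D y" for y
    unfolding score_def by (rule gradient_eqI)
  then have "(\<Sum>y\<in>UNIV. pmf (\<pi> \<theta> x) y *\<^sub>R score \<pi> \<theta> x y) = (\<Sum>y\<in>UNIV. D y)"
    using pos by (simp add: less_imp_neq[symmetric])
  also have "\<dots> = gradient (\<lambda>\<theta>'. \<Sum>y\<in>UNIV. pmf (\<pi> \<theta>' x) y) \<theta>"
    using GDERIV_sum[OF D] by (rule gradient_eqI[symmetric])
  also have "\<dots> = 0"
    by (intro gradient_eqI) (simp add: sum_pmf_eq_1 GDERIV_const)
  finally show ?thesis .
qed

section \<open>Expectations over finitely many responses\<close>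

lemma expectation_finite:
  fixes f :: "'y::finite \<Rightarrow> 'b::{banach, second_countable_topology}"
  shows "measure_pmf.expectation p f = (\<Sum>y\<in>UNIV. pmf p y *\<^sub>R f y)"
  by (rule integral_measure_pmf) auto

lemma is_policy_imp_measurable_pmf:
  assumes "is_policy \<rho> p"
  shows "(\<lambda>x. pmf (p x) y) \<in> borel_measurable \<rho>"
  using assms unfolding is_policy_def pmf.rep_eq
  by (rule measurable_compose) (rule measurable_measure_prob_algebra, simp)

text \<open>After centering \<^term>\<open>h\<close> under \<^term>\<open>p\<close>, the cross term of the square vanishes by independence.\<close>

lemma expectation_pairwise_square:
  fixes p q m :: "'y::finite pmf" and h :: "'y \<Rightarrow> real"
  assumes m: "\<And>y. pmf m y = (pmf p y + pmf q y) / 2"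
  shows "measure_pmf.expectation (pair_pmf p q) (\<lambda>(y, y'). (h y - h y')\<^sup>2) =
    2 * measure_pmf.expectation m (\<lambda>y. (h y - measure_pmf.expectation p h)\<^sup>2)"
proof -
  define u where "u y = h y - measure_pmf.expectation p h" for y
  have one: "(\<Sum>y\<in>UNIV. pmf p y) = 1" "(\<Sum>y\<in>UNIV. pmf q y) = 1"
    by (simp_all add: sum_pmf_eq_1)
  have centered: "(\<Sum>y\<in>UNIV. pmf p y * u y) = 0"
    by (simp add: u_def right_diff_distrib sum_subtractf expectation_finite one flip: sum_distrib_right)
  \<comment> \<open>Subtracting a constant leaves differences unchanged, so \<open>u\<close> may
    replace \<open>h\<close>.\<close>
  have "measure_pmf.expectation (pair_pmf p q) (\<lambda>(y, y'). (h y - h y')\<^sup>2)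
      = (\<Sum>y\<in>UNIV. \<Sum>y'\<in>UNIV. pmf p y * pmf q y' * (u y - u y')\<^sup>2)"
    by (simp add: expectation_finite u_def pmf_pair sum.cartesian_product' flip: UNIV_Times_UNIV)
  also have "\<dots> = (\<Sum>y\<in>UNIV. \<Sum>y'\<in>UNIV. (pmf p y * (u y)\<^sup>2) * pmf q y')
      + (\<Sum>y\<in>UNIV. \<Sum>y'\<in>UNIV. pmf p y * (pmf q y' * (u y')\<^sup>2))
      - 2 * (\<Sum>y\<in>UNIV. \<Sum>y'\<in>UNIV. (pmf p y * u y) * (pmf q y' * u y'))"
    by (simp add: power2_diff algebra_simps sum.distrib sum_subtractf sum_distrib_left)
  also have "\<dots> = (\<Sum>y\<in>UNIV. pmf p y * (u y)\<^sup>2) + (\<Sum>y\<in>UNIV. pmf q y * (u y)\<^sup>2)"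
    by (simp only: sum_product[symmetric] one centered)
  also have "\<dots> = 2 * measure_pmf.expectation m (\<lambda>y. (u y)\<^sup>2)"
    by (simp add: expectation_finite m sum_distrib_left distrib_right add_divide_distrib flip: sum.distrib)
  finally show ?thesis by (simp add: u_def)
qed

section \<open>The pairwise loss as a quadratic form in the Fisher matrix\<close>

lemma outer_product_mult_vector:
  fixes u :: "real^'m" and v w :: "real^'n"
  shows "(columnvector u ** (rowvector v :: real^'n^1)) *v w = (v \<bullet> w) *\<^sub>R u"
  by (simp add: vec_eq_iff columnvector_def rowvector_def matrix_matrix_mult_def
      matrix_vector_mult_def inner_vec_def sum_distrib_left mult_ac)

text \<open>Supplies both the continuity behind measurability of the Fisher integrand and the norm
  bound behind its integrability.\<close>

lemma bounded_bilinear_outer_product: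
  "bounded_bilinear (\<lambda>(u::real^'m) (v::real^'n). columnvector u ** (rowvector v :: real^'n^1))"
  by (simp add: bilinear_def linear_iff vec_eq_iff columnvector_def rowvector_def
      matrix_matrix_mult_def distrib_left distrib_right flip: bilinear_conv_bounded_bilinear)

text \<open>The reward and its mean are both bounded by the root \<open>R\<close> of the maximal
  squared reward. The advantage thus inherits an integrable envelope.\<close>

lemma advantage_square_le:
  fixes p :: "'x \<Rightarrow> 'y::finite pmf"
  shows "(advantage p r x y)\<^sup>2 \<le> 4 * (MAX y. (r x y)\<^sup>2)"
proof -
  define R where "R = sqrt (MAX y. (r x y)\<^sup>2)"
  have r: "\<bar>r x y\<bar> \<le> R" for y
    unfolding R_def by (rule real_le_rsqrt) simp
  have "\<bar>measure_pmf.expectation (p x) (r x)\<bar> \<le> (\<Sum>y\<in>UNIV. pmf (p x) y * R)"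
    unfolding expectation_finite
    by (rule order_trans[OF sum_abs]) (auto simp: abs_mult intro!: sum_mono mult_left_mono r)
  then have "\<bar>measure_pmf.expectation (p x) (r x)\<bar> \<le> R"
    by (simp add: sum_pmf_eq_1 flip: sum_distrib_right)
  with r[of y] have "\<bar>advantage p r x y\<bar> \<le> 2 * R"
    unfolding advantage_def by linarith
  then have "(advantage p r x y)\<^sup>2 \<le> (2 * R)\<^sup>2"
    by (metis abs_ge_zero power2_abs power_mono)
  moreover have "0 \<le> (MAX y. (r x y)\<^sup>2)"
    by (rule order_trans[of _ "(r x y)\<^sup>2"]) simp_all
  ultimately show ?thesis by (simp add: R_def power_mult_distrib)
qed

text \<open>The map \<open>g\<close> stands for the score: its zero mean under \<open>p\<close> is
  what turns the reward into the advantage. Evaluating the loss at \<open>\<eta> *\<^sub>R v\<close>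
  cancels the factor \<open>1 / \<eta>\<close>. Both conclusions rest on writing the bilinear form
  of \<open>F\<close> as an integral, with integrability coming from the envelopes \<open>R\<close>
  and \<open>G\<close>.\<close>

lemma
  fixes p q :: "'x \<Rightarrow> 'y::finite pmf" and g :: "'x \<Rightarrow> 'y \<Rightarrow> real^'d"
  assumes p: "is_policy \<rho> p" and q: "is_policy \<rho> q"
    and r_meas: "(\<lambda>(x, y). r x y) \<in> borel_measurable (\<rho> \<Otimes>\<^sub>M count_space UNIV)"
    and g_meas: "\<And>y. (\<lambda>x. g x y) \<in> borel_measurable \<rho>"
    and r_int: "integrable \<rho> (\<lambda>x. MAX y. (r x y)\<^sup>2)"
    and g_int: "integrable \<rho> (\<lambda>x. MAX y. (norm (g x y))\<^sup>2)"
    and centered: "\<And>x. x \<in> space \<rho> \<Longrightarrow> (\<Sum>y\<in>UNIV. pmf (p x) y *\<^sub>R g x y) = 0"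
    and "\<eta> \<noteq> 0"
  defines "F \<equiv> fisher_matrix \<rho> (mix_policy p q) g"
    and "b \<equiv> policy_expectation \<rho> (mix_policy p q) (\<lambda>x y. advantage p r x y *\<^sub>R g x y)"
    and "c \<equiv> policy_expectation \<rho> (mix_policy p q) (\<lambda>x y. (advantage p r x y)\<^sup>2)"
  shows transpose_fisher_matrix_mix_policy: "transpose F = F"
    and pairwise_loss_eq_quadratic:
      "pairwise_loss \<rho> \<eta> p q r g (\<eta> *\<^sub>R v) = 2 * (v \<bullet> (F *v v) - 2 * (b \<bullet> v) + c)"
proof -
  define m where "m x y = pmf (mix_policy p q x) y" for x y
  define a where "a = advantage p r"
  define R where "R x = (MAX y. (r x y)\<^sup>2)" for x
  define G where "G x = (MAX y. (norm (g x y))\<^sup>2)" for x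
  let ?O = "\<lambda>x y. columnvector (g x y) ** (rowvector (g x y) :: real^'d^1)"
  have [measurable]: "(\<lambda>x. pmf (p x) y) \<in> borel_measurable \<rho>" "(\<lambda>x. pmf (q x) y) \<in> borel_measurable \<rho>" for y
    using p q by (auto intro: is_policy_imp_measurable_pmf)
  have [measurable]: "(\<lambda>x. m x y) \<in> borel_measurable \<rho>" for y
    unfolding m_def pmf_mix_policy by measurable
  note g_meas[measurable]
  have [measurable]: "(\<lambda>x. r x y) \<in> borel_measurable \<rho>" for y
    using measurable_compose[OF measurable_Pair2'[of y "count_space UNIV" \<rho>] r_meas] by simp
  have [measurable]: "(\<lambda>x. a x y) \<in> borel_measurable \<rho>" for y
    unfolding a_def advantage_def expectation_finite by measurable
  have [measurable]: "(\<lambda>x. ?O x y) \<in> borel_measurable \<rho>" for y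
  proof -
    have "continuous_on UNIV (\<lambda>v. columnvector v ** (rowvector v :: real^'d^1) :: real^'d^'d)"
      by (intro bounded_bilinear.continuous_on[OF bounded_bilinear_outer_product] continuous_intros)
    from borel_measurable_continuous_onI[OF this] show ?thesis
      by measurable
  qed
  have m: "0 \<le> m x y" "m x y \<le> 1" for x y
    by (simp_all add: m_def pmf_le_1)
  have a_le: "(a x y)\<^sup>2 \<le> 4 * R x" for x y
    unfolding a_def R_def by (rule advantage_square_le)
  have g_le: "(norm (g x y))\<^sup>2 \<le> G x" for x y
    unfolding G_def by simp
  have G0: "0 \<le> G x" for x
    using g_le order_trans zero_le_power2 by blast
  have R0: "0 \<le> R x" for x
    unfolding R_def by (rule order_trans[of _ "(r x undefined)\<^sup>2"]) simp_all
  have [simp]: "integrable \<rho> R" "integrable \<rho> G"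
    using r_int g_int unfolding R_def G_def by simp_all
  \<comment> \<open>The mixture weights lie between 0 and 1, so any envelope of \<open>f\<close>
    also dominates the weighted function. The codomain is left general to cover matrices, vectors
    and reals.\<close>
  have int_m: "integrable \<rho> (\<lambda>x. m x y *\<^sub>R f x)"
    if "f \<in> borel_measurable \<rho>" "integrable \<rho> w" "\<And>x. norm (f x) \<le> w x"
    for y w and f :: "'x \<Rightarrow> 'b::{banach, second_countable_topology}"
  proof (rule Bochner_Integration.integrable_bound[OF that(2)])
    show "AE x in \<rho>. norm (m x y *\<^sub>R f x) \<le> norm (w x)"
    proof (rule AE_I2)
      fix x
      have "norm (m x y *\<^sub>R f x) \<le> 1 * norm (f x)"
        unfolding norm_scaleR using m by (intro mult_right_mono) simp_all
      then show "norm (m x y *\<^sub>R f x) \<le> norm (w x)"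
        using that(3)[of x] by simp
    qed
  qed (use that(1) in measurable)
  obtain K where K: "\<And>(u :: real^'d) (v :: real^'d). norm (columnvector u ** (rowvector v :: real^'d^1)) \<le> norm u * norm v * K"
    using bounded_bilinear.bounded[OF bounded_bilinear_outer_product] by blast
  have O_int: "integrable \<rho> (\<lambda>x. m x y *\<^sub>R ?O x y)" for y
  proof (rule int_m)
    \<comment> \<open>The absolute value is taken because the sign of \<open>K\<close> was not
      recorded.\<close>
    show "integrable \<rho> (\<lambda>x. G x * \<bar>K\<bar>)" by simp
    fix x
    have "norm (?O x y) \<le> (norm (g x y))\<^sup>2 * K"
      using K[of "g x y" "g x y"] by (simp add: power2_eq_square)
    also have "\<dots> \<le> G x * \<bar>K\<bar>"
      using g_le G0 by (intro order_trans[OF mult_left_mono[OF abs_ge_self] mult_right_mono]) auto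
    finally show "norm (?O x y) \<le> G x * \<bar>K\<bar>" .
  qed simp
  have ag_int: "integrable \<rho> (\<lambda>x. m x y *\<^sub>R a x y *\<^sub>R g x y)" for y
  proof (rule int_m)
    show "integrable \<rho> (\<lambda>x. 4 * R x + G x)" by simp
    fix x
    have "2 * (\<bar>a x y\<bar> * norm (g x y)) \<le> (a x y)\<^sup>2 + (norm (g x y))\<^sup>2"
      using sum_squares_bound[of "\<bar>a x y\<bar>" "norm (g x y)"] by simp
    also have "\<dots> \<le> 4 * R x + G x"
      using a_le[of x y] g_le[of x y] by simp
    finally show "norm (a x y *\<^sub>R g x y) \<le> 4 * R x + G x"
      using R0[of x] G0[of x] by simp
  qed simp
  have aa_int: "integrable \<rho> (\<lambda>x. m x y * (a x y)\<^sup>2)" for y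
    using int_m[of "\<lambda>x. (a x y)\<^sup>2" "\<lambda>x. 4 * R x" y] a_le by simp
  have F: "F = (\<integral>x. (\<Sum>y\<in>UNIV. m x y *\<^sub>R ?O x y) \<partial>\<rho>)"
    unfolding F_def fisher_matrix_def policy_expectation_def expectation_finite m_def ..
  have b: "b = (\<integral>x. (\<Sum>y\<in>UNIV. m x y *\<^sub>R a x y *\<^sub>R g x y) \<partial>\<rho>)"
    unfolding b_def policy_expectation_def expectation_finite m_def a_def ..
  have c: "c = (\<integral>x. (\<Sum>y\<in>UNIV. m x y * (a x y)\<^sup>2) \<partial>\<rho>)"
    unfolding c_def policy_expectation_def expectation_finite m_def a_def by simp
  have F_inner: "integrable \<rho> (\<lambda>x. \<Sum>y\<in>UNIV. m x y * ((g x y \<bullet> v) * (g x y \<bullet> w)))"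
    "w \<bullet> (F *v v) = (\<integral>x. (\<Sum>y\<in>UNIV. m x y * ((g x y \<bullet> v) * (g x y \<bullet> w))) \<partial>\<rho>)" for v w
  proof -
    \<comment> \<open>Being bounded and linear, this functional commutes with the matrix-valued
      integral and reduces it to a scalar one.\<close>
    have T: "bounded_linear (\<lambda>M :: real^'d^'d. w \<bullet> (M *v v))"
      by (intro linear_conv_bounded_linear[THEN iffD1] linearI)
         (simp_all add: matrix_vector_mult_add_rdistrib inner_add_right scaleR_matrix_vector_assoc[symmetric])
    have *: "w \<bullet> ((\<Sum>y\<in>UNIV. m x y *\<^sub>R ?O x y) *v v)
        = (\<Sum>y\<in>UNIV. m x y * ((g x y \<bullet> v) * (g x y \<bullet> w)))" for x
      by (simp add: linear_sum[OF bounded_linear.linear[OF T]] outer_product_mult_vector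
          scaleR_matrix_vector_assoc[symmetric] inner_commute mult.assoc)
    have int: "integrable \<rho> (\<lambda>x. \<Sum>y\<in>UNIV. m x y *\<^sub>R ?O x y)"
      using O_int by simp
    show "integrable \<rho> (\<lambda>x. \<Sum>y\<in>UNIV. m x y * ((g x y \<bullet> v) * (g x y \<bullet> w)))"
      using integrable_bounded_linear[OF T int] by (simp add: *)
    show "w \<bullet> (F *v v) = (\<integral>x. (\<Sum>y\<in>UNIV. m x y * ((g x y \<bullet> v) * (g x y \<bullet> w))) \<partial>\<rho>)"
      using integral_bounded_linear[OF T int] by (simp add: * F)
  qed
  show "transpose F = F"
    unfolding symmetric_matrix_iff
    by (metis (no_types, lifting) F_inner(2) inner_commute mult.commute sum.cong Bochner_Integration.integral_cong)
  have b_inner: "integrable \<rho> (\<lambda>x. \<Sum>y\<in>UNIV. m x y * (a x y * (g x y \<bullet> v)))"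
    "b \<bullet> v = (\<integral>x. (\<Sum>y\<in>UNIV. m x y * (a x y * (g x y \<bullet> v))) \<partial>\<rho>)"
  proof -
    have int: "integrable \<rho> (\<lambda>x. \<Sum>y\<in>UNIV. m x y *\<^sub>R a x y *\<^sub>R g x y)"
      using ag_int by simp
    show "integrable \<rho> (\<lambda>x. \<Sum>y\<in>UNIV. m x y * (a x y * (g x y \<bullet> v)))"
      using integrable_bounded_linear[OF bounded_linear_inner_left int, of v]
      by (simp add: inner_sum_left mult.assoc)
    show "b \<bullet> v = (\<integral>x. (\<Sum>y\<in>UNIV. m x y * (a x y * (g x y \<bullet> v))) \<partial>\<rho>)"
      using integral_bounded_linear[OF bounded_linear_inner_left int, of v]
      by (simp add: inner_sum_left mult.assoc b)
  qed
  have c_int: "integrable \<rho> (\<lambda>x. \<Sum>y\<in>UNIV. m x y * (a x y)\<^sup>2)"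
    using aa_int by simp
  have "measure_pmf.expectation (pair_pmf (p x) (q x))
        (\<lambda>(y, y'). (1 / \<eta> * ((g x y - g x y') \<bullet> (\<eta> *\<^sub>R v)) - (r x y - r x y'))\<^sup>2)
      = 2 * ((\<Sum>y\<in>UNIV. m x y * ((g x y \<bullet> v) * (g x y \<bullet> v)))
         - 2 * (\<Sum>y\<in>UNIV. m x y * (a x y * (g x y \<bullet> v))) + (\<Sum>y\<in>UNIV. m x y * (a x y)\<^sup>2))"
    if "x \<in> space \<rho>" for x
  proof -
    define h where "h y = g x y \<bullet> v - r x y" for y
    have "(\<Sum>y\<in>UNIV. pmf (p x) y * (g x y \<bullet> v)) = (\<Sum>y\<in>UNIV. pmf (p x) y *\<^sub>R g x y) \<bullet> v"
      by (simp add: inner_sum_left)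
    \<comment> \<open>The zero mean of \<open>g\<close> leaves only the reward in the mean of
      \<open>h\<close>, so centering \<open>h\<close> replaces the reward by the advantage.\<close>
    then have "measure_pmf.expectation (p x) h = - measure_pmf.expectation (p x) (r x)"
      by (simp add: expectation_finite h_def right_diff_distrib sum_subtractf centered[OF that])
    then have h: "h y - measure_pmf.expectation (p x) h = g x y \<bullet> v - a x y" for y
      by (simp add: h_def a_def advantage_def)
    have "(\<lambda>(y, y'). (1 / \<eta> * ((g x y - g x y') \<bullet> (\<eta> *\<^sub>R v)) - (r x y - r x y'))\<^sup>2)
        = (\<lambda>(y, y'). (h y - h y')\<^sup>2)"
      using \<open>\<eta> \<noteq> 0\<close> by (simp add: fun_eq_iff h_def inner_diff_left algebra_simps)
    then have "measure_pmf.expectation (pair_pmf (p x) (q x))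
          (\<lambda>(y, y'). (1 / \<eta> * ((g x y - g x y') \<bullet> (\<eta> *\<^sub>R v)) - (r x y - r x y'))\<^sup>2)
        = 2 * (\<Sum>y\<in>UNIV. m x y * (g x y \<bullet> v - a x y)\<^sup>2)"
      using expectation_pairwise_square[OF pmf_mix_policy[of p q x], of h]
      unfolding h expectation_finite[of "mix_policy p q x"] by (simp only: m_def real_scaleR_def)
    also have "(\<Sum>y\<in>UNIV. m x y * (g x y \<bullet> v - a x y)\<^sup>2)
        = (\<Sum>y\<in>UNIV. m x y * ((g x y \<bullet> v) * (g x y \<bullet> v)))
         - 2 * (\<Sum>y\<in>UNIV. m x y * (a x y * (g x y \<bullet> v))) + (\<Sum>y\<in>UNIV. m x y * (a x y)\<^sup>2)"
      unfolding sum_distrib_left sum_subtractf[symmetric] sum.distrib[symmetric]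
      by (intro sum.cong) (simp_all add: power2_eq_square algebra_simps)
    finally show ?thesis .
  qed
  then have "pairwise_loss \<rho> \<eta> p q r g (\<eta> *\<^sub>R v) =
      (\<integral>x. 2 * ((\<Sum>y\<in>UNIV. m x y * ((g x y \<bullet> v) * (g x y \<bullet> v)))
         - 2 * (\<Sum>y\<in>UNIV. m x y * (a x y * (g x y \<bullet> v))) + (\<Sum>y\<in>UNIV. m x y * (a x y)\<^sup>2)) \<partial>\<rho>)"
    unfolding pairwise_loss_def policy_expectation_def
    by (intro Bochner_Integration.integral_cong) simp_all
  also have "\<dots> = 2 * (v \<bullet> (F *v v) - 2 * (b \<bullet> v) + c)"
    unfolding F_inner(2) b_inner(2) c using F_inner(1)[of v v] b_inner(1) c_int by simp
  finally show "pairwise_loss \<rho> \<eta> p q r g (\<eta> *\<^sub>R v) = 2 * (v \<bullet> (F *v v) - 2 * (b \<bullet> v) + c)" .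
qed

theorem claim1:
  fixes \<rho> :: "'x measure"
    and \<pi> :: "real^'d \<Rightarrow> 'x \<Rightarrow> 'y::finite pmf"
    and \<theta>\<^sub>t :: "real^'d"
    and \<mu> :: "'x \<Rightarrow> 'y pmf"
    and r :: "'x \<Rightarrow> 'y \<Rightarrow> real"
    and \<eta> :: real
    and \<delta> :: "real^'d"
  assumes "prob_space \<rho>"
    and "\<eta> > 0"
    and "\<And>\<theta>. is_policy \<rho> (\<pi> \<theta>)"
    and "\<And>\<theta> x y. x \<in> space \<rho> \<Longrightarrow> pmf (\<pi> \<theta> x) y > 0"
    and "\<And>\<theta> x y. x \<in> space \<rho> \<Longrightarrow> (\<lambda>\<theta>'. pmf (\<pi> \<theta>' x) y) differentiable (at \<theta>)"
    and "is_policy \<rho> \<mu>"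
    and "(\<lambda>(x, y). r x y) \<in> borel_measurable (\<rho> \<Otimes>\<^sub>M count_space UNIV)"
    and "integrable \<rho> (\<lambda>x. MAX y. (r x y)\<^sup>2)"
    and "integrable \<rho> (\<lambda>x. MAX y. (norm (score \<pi> \<theta>\<^sub>t x y))\<^sup>2)"
  shows "is_min_norm_minimizer (pairwise_loss \<rho> \<eta> (\<pi> \<theta>\<^sub>t) \<mu> r (score \<pi> \<theta>\<^sub>t)) \<delta> \<longleftrightarrow>
    \<delta> = \<eta> *\<^sub>R
      (pseudo_inverse (fisher_matrix \<rho> (mix_policy (\<pi> \<theta>\<^sub>t) \<mu>) (score \<pi> \<theta>\<^sub>t)) *v
       policy_expectation \<rho> (mix_policy (\<pi> \<theta>\<^sub>t) \<mu>)
         (\<lambda>x y. advantage (\<pi> \<theta>\<^sub>t) r x y *\<^sub>R score \<pi> \<theta>\<^sub>t x y))"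
proof -
  define g where "g = score \<pi> \<theta>\<^sub>t"
  have p_meas: "(\<lambda>x. pmf (\<pi> \<theta> x) y) \<in> borel_measurable \<rho>" for \<theta> y
    using assms(3) by (rule is_policy_imp_measurable_pmf)
  have g_meas: "(\<lambda>x. g x y) \<in> borel_measurable \<rho>" for y
    unfolding g_def score_def
    by (intro borel_measurable_gradient borel_measurable_ln p_meas differentiable_ln_compose assms(4,5))
  have centered: "(\<Sum>y\<in>UNIV. pmf (\<pi> \<theta>\<^sub>t x) y *\<^sub>R g x y) = 0" if "x \<in> space \<rho>" for x
    unfolding g_def using assms(4,5)[OF that] by (rule expectation_score_eq_0)
  have "\<eta> \<noteq> 0"
    using \<open>\<eta> > 0\<close> by simp
  note assms(3)[of \<theta>\<^sub>t] assms(6,7) g_meas assms(8) assms(9)[folded g_def] centered this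
  note quadratic = transpose_fisher_matrix_mix_policy[OF this] pairwise_loss_eq_quadratic[OF this]
  \<comment> \<open>The integrand is a mean of squares.\<close>
  have "0 \<le> pairwise_loss \<rho> \<eta> (\<pi> \<theta>\<^sub>t) \<mu> r g v" for v
    unfolding pairwise_loss_def policy_expectation_def
    by (intro Bochner_Integration.integral_nonneg) (auto split: prod.split)
  from is_min_norm_minimizer_quadratic[OF quadratic(1) _ \<open>\<eta> > 0\<close> quadratic(2) this]
  show ?thesis
    by (simp add: g_def)
qed

end
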